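(* Let $n\ge 2$, let $D\in\mathbb{R}^{n\times n}$ be a positive-definite diagonal matrix whose condition number satisfies $\kappa(D)\leq\tilde\kappa$, and let $k\in\{1,\ldots,n\}$. The variance of $Y_k(D)$ satisfies $$\operatorname{var}(Y_k(D))\leq\frac{k}{4}\left(\frac{n-k}{n-1}\right)(\log\tilde\kappa)^2.$$
   Context: For a positive-definite $n\times n$ matrix $D$ with eigenvalues $\lambda_1(D)\geq\cdots\geq\lambda_n(D)>0$, the condition number is $\kappa(D)=\lambda_1(D)/\lambda_n(D)$. For a $k$-element index set $I\subseteq\{1,\ldots,n\}$, $D_I:=[D_{i,j}]_{i,j\in I}$ is the corresponding principal $k\times k$ submatrix of $D$. The random matrix $A_k(D)$ is $D_I$ with $I$ chosen uniformly at random among the $\binom{n}{k}$ $k$-element subsets of $\{1,\ldots,n\}$, and $Y_k(D):=\log(\det A_k(D))$. Here $\log$ is the logarithm to a fixed base greater than $1$, the same one throughout. *)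

theory Defs
  imports
    "HOL-Probability.Probability_Mass_Function"
    "Jordan_Normal_Form.DL_Submatrix"
    "Jordan_Normal_Form.Spectral_Radius"
begin

definition positive_definite_mat :: "real mat \<Rightarrow> bool" where
  "positive_definite_mat D \<longleftrightarrow>
     square_mat D \<and> transpose_mat D = D \<and>
     (\<forall>v \<in> carrier_vec (dim_row D). v \<noteq> 0\<^sub>v (dim_row D) \<longrightarrow> scalar_prod v (D *\<^sub>v v) > 0)"

(* The spectrum here consists of the real eigenvalues; for a symmetric matrix these are all of them.
   Meaningful only if the dimension is positive and the least eigenvalue is nonzero. *)
definition condition_number :: "real mat \<Rightarrow> real" where
  "condition_number D = Max (spectrum D) / Min (spectrum D)"

(* The law of A_k(D). Indices are 0-based. For k > dim_row D no k-subset exists and the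
   term is unspecified. *)
definition random_principal_submatrix :: "nat \<Rightarrow> real mat \<Rightarrow> real mat pmf" where
  "random_principal_submatrix k D =
     map_pmf (\<lambda>I. submatrix D I I) (pmf_of_set {I. I \<subseteq> {0..<dim_row D} \<and> card I = k})"

(* Y_k(D) is log_det b evaluated at the random matrix A_k(D); b is the base of the logarithm. *)
definition log_det :: "real \<Rightarrow> real mat \<Rightarrow> real" where
  "log_det b A = log b (Determinant.det A)"

end

theory Submission
  imports Defs
begin

text \<open>
  Since a principal minor of a diagonal matrix is a product of diagonal entries, the random
  variable is the sum of the logarithms of the diagonal entries over a random subset, i.e. over a
  sample drawn without replacement. Its mean square deviation from \<open>k\<close> times the population mean is found by double counting the pairs of
  indices in a subset. The population variance is at most a quarter of the squared range
  (Popoviciu), and the range of the logarithms is the logarithm of the condition number.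
\<close>

section \<open>Subset counts and sums of squares over all k-subsets\<close>

lemma card_supersets:
  assumes "finite A" "T \<subseteq> A" "card T \<le> k"
  shows "card {I. T \<subseteq> I \<and> I \<subseteq> A \<and> card I = k} = (card A - card T) choose (k - card T)"
proof -
  have T: "finite T" using assms finite_subset by blast
  have "bij_betw (\<lambda>I. I - T) {I. T \<subseteq> I \<and> I \<subseteq> A \<and> card I = k}
          {J. J \<subseteq> A - T \<and> card J = k - card T}"
  proof (rule bij_betwI[where g = "\<lambda>J. J \<union> T"])
    show "(\<lambda>I. I - T) \<in> {I. T \<subseteq> I \<and> I \<subseteq> A \<and> card I = k} \<rightarrow> {J. J \<subseteq> A - T \<and> card J = k - card T}"
      using T by (auto simp: card_Diff_subset)
    show "(\<lambda>J. J \<union> T) \<in> {J. J \<subseteq> A - T \<and> card J = k - card T} \<rightarrow> {I. T \<subseteq> I \<and> I \<subseteq> A \<and> card I = k}"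
    proof (intro funcsetI CollectI)
      fix J assume J: "J \<in> {J. J \<subseteq> A - T \<and> card J = k - card T}"
      then have "finite J" using assms(1) finite_subset by auto
      then have "card (J \<union> T) = card J + card T"
        using J T by (intro card_Un_disjoint) auto
      then show "T \<subseteq> J \<union> T \<and> J \<union> T \<subseteq> A \<and> card (J \<union> T) = k"
        using J assms by auto
    qed
  qed auto
  then have "card {I. T \<subseteq> I \<and> I \<subseteq> A \<and> card I = k} = card {J. J \<subseteq> A - T \<and> card J = k - card T}"
    by (rule bij_betw_same_card)
  then show ?thesis
    using assms T by (simp add: n_subsets card_Diff_subset)
qed

lemma real_binomial_absorption:
  assumes "1 \<le> k" "k \<le> n"
  shows "real n * real ((n - 1) choose (k - 1)) = real k * real (n choose k)"
proof -
  have "k * (n choose k) = n * ((n - 1) choose (k - 1))"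
    using assms by (simp add: times_binomial_minus1_eq)
  then show ?thesis by (metis of_nat_mult)
qed

text \<open>Binomial absorption applied twice, once for each of the two points. The identity is
  cleared of denominators so that it can be substituted directly as a weight.\<close>

lemma card_subsets_containing_pair:
  assumes "finite A" "i \<in> A" "j \<in> A" "i \<noteq> j" "1 \<le> k" "k \<le> card A"
  shows "real (card A) * (real (card A) - 1) * real (card {I. {i, j} \<subseteq> I \<and> I \<subseteq> A \<and> card I = k})
           = real k * (real k - 1) * real (card A choose k)"
\<comment> \<open>For \<open>k = 1\<close> truncated subtraction would turn the count into
  \<open>(card A - 2) choose 0 = 1\<close>, although no singleton contains two distinct points. Here
  both sides are zero.\<close>
proof (cases "k = 1")
  case True
  have "{I. {i, j} \<subseteq> I \<and> I \<subseteq> A \<and> card I = k} = {}"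
    using assms(4) True by (auto simp: card_1_singleton_iff)
  then show ?thesis using True by (simp only: card.empty) simp
next
  case False
  let ?n = "card A"
  have k: "2 \<le> k" using False assms by simp
  have "card {I. {i, j} \<subseteq> I \<and> I \<subseteq> A \<and> card I = k} = (?n - 2) choose (k - 2)"
    using card_supersets[of A "{i, j}" k] assms k by (simp add: numeral_2_eq_2)
  moreover have "real (?n - 1) * real ((?n - 2) choose (k - 2)) = real (k - 1) * real ((?n - 1) choose (k - 1))"
    using real_binomial_absorption[of "k - 1" "?n - 1"] k assms by (simp add: numeral_2_eq_2)
  moreover have "real ?n * real ((?n - 1) choose (k - 1)) = real k * real (?n choose k)"
    using real_binomial_absorption assms by blast
  moreover have "real (?n - 1) = real ?n - 1" "real (k - 1) = real k - 1"
    using k assms by (auto simp: of_nat_diff)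
  ultimately show ?thesis by (metis (no_types, lifting) mult.assoc mult.left_commute)
qed

text \<open>Expanding the square and exchanging sums weights each product \<open>c i * c j\<close>
  by the number of k-subsets containing both indices. That weight is constant off the diagonal, so
  its constant part multiplies the square of \<open>sum c A\<close>, which vanishes. Only the excess
  weight on the diagonal survives.\<close>

lemma sum_square_subset_sums:
  fixes c :: "'a \<Rightarrow> real"
  assumes A: "finite A" and k: "1 \<le> k" "k \<le> card A" and c: "sum c A = 0"
  defines "n \<equiv> card A"
  shows "real n * (real n - 1) * (\<Sum>I | I \<subseteq> A \<and> card I = k. (sum c I)\<^sup>2)
           = real k * (real n - real k) * real (n choose k) * (\<Sum>i\<in>A. (c i)\<^sup>2)"
proof -
  let ?S = "{I. I \<subseteq> A \<and> card I = k}"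
  let ?N = "\<lambda>i j. real (card {I. {i, j} \<subseteq> I \<and> I \<subseteq> A \<and> card I = k})"
  let ?C = "real (n choose k)"
  have S: "finite ?S" using A by simp
  \<comment> \<open>With an indicator the double sum runs over all of \<open>A\<close>; its range no
    longer depends on \<open>I\<close>, so the sums can be exchanged.\<close>
  have square: "(sum c I)\<^sup>2 = (\<Sum>i\<in>A. \<Sum>j\<in>A. if {i, j} \<subseteq> I then c i * c j else 0)"
    if "I \<in> ?S" for I
  proof -
    have sum_I: "sum c I = (\<Sum>i\<in>A. if i \<in> I then c i else 0)"
      using that A by (auto simp: sum.If_cases Int_absorb1)
    show ?thesis
      unfolding sum_I power2_eq_square sum_product by (intro sum.cong refl) auto
  qed
  have count: "(\<Sum>I\<in>?S. if {i, j} \<subseteq> I then c i * c j else 0) = c i * c j * ?N i j" for i j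
  proof -
    have "?S \<inter> {I. {i, j} \<subseteq> I} = {I. {i, j} \<subseteq> I \<and> I \<subseteq> A \<and> card I = k}" by auto
    then show ?thesis using S by (simp add: sum.If_cases)
  qed
  have "(\<Sum>I\<in>?S. (sum c I)\<^sup>2) = (\<Sum>I\<in>?S. \<Sum>i\<in>A. \<Sum>j\<in>A. if {i, j} \<subseteq> I then c i * c j else 0)"
    using square by (rule sum.cong[OF refl])
  also have "\<dots> = (\<Sum>i\<in>A. \<Sum>j\<in>A. \<Sum>I\<in>?S. if {i, j} \<subseteq> I then c i * c j else 0)"
    by (subst sum.swap, intro sum.cong refl, rule sum.swap)
  finally have total: "(\<Sum>I\<in>?S. (sum c I)\<^sup>2) = (\<Sum>i\<in>A. \<Sum>j\<in>A. c i * c j * ?N i j)"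
    unfolding count .
  \<comment> \<open>The diagonal weight is \<open>k * (n - 1)\<close> times the binomial
    coefficient, the off-diagonal one \<open>k * (k - 1)\<close> times it. Their difference is the
    source of the factor \<open>n - k\<close>.\<close>
  have weight: "real n * (real n - 1) * ?N i j
      = real k * (real k - 1) * ?C + (if i = j then real k * (real n - real k) * ?C else 0)"
    if "i \<in> A" "j \<in> A" for i j
  proof (cases "i = j")
    case True
    have "{I. {i, j} \<subseteq> I \<and> I \<subseteq> A \<and> card I = k} = {I. {i} \<subseteq> I \<and> I \<subseteq> A \<and> card I = k}"
      using True by auto
    then have "?N i j = real ((n - 1) choose (k - 1))"
      using card_supersets[of A "{i}" k] that A k by (simp add: n_def)
    then have "real n * ?N i j = real k * ?C"
      using real_binomial_absorption k by (simp add: n_def)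
    moreover have "real n * (real n - 1) * ?N i j = (real n - 1) * (real n * ?N i j)"
      by simp
    ultimately have "real n * (real n - 1) * ?N i j = (real n - 1) * (real k * ?C)"
      by (simp only:)
    then show ?thesis using True by (simp only: if_True) (simp add: algebra_simps)
  next
    case False
    then show ?thesis
      using card_subsets_containing_pair[OF A that False k] by (simp add: n_def)
  qed
  have "real n * (real n - 1) * (\<Sum>I\<in>?S. (sum c I)\<^sup>2)
      = (\<Sum>i\<in>A. \<Sum>j\<in>A. c i * c j * (real n * (real n - 1) * ?N i j))"
    unfolding total by (simp add: sum_distrib_left mult_ac)
  also have "\<dots> = (\<Sum>i\<in>A. \<Sum>j\<in>A. real k * (real k - 1) * ?C * (c i * c j)
      + (if i = j then real k * (real n - real k) * ?C * (c i * c j) else 0))"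
    by (intro sum.cong refl) (simp only: weight, simp add: distrib_left mult_ac)
  also have "\<dots> = real k * (real k - 1) * ?C * (sum c A * sum c A)
      + (\<Sum>i\<in>A. real k * (real n - real k) * ?C * (c i)\<^sup>2)"
  proof -
    have "(\<Sum>j\<in>A. if i = j then real k * (real n - real k) * ?C * (c i * c j) else 0)
        = real k * (real n - real k) * ?C * (c i)\<^sup>2" if "i \<in> A" for i
      using A that by (simp only: sum.delta' if_True power2_eq_square)
    moreover have "(\<Sum>i\<in>A. \<Sum>j\<in>A. real k * (real k - 1) * ?C * (c i * c j))
        = real k * (real k - 1) * ?C * (sum c A * sum c A)"
      unfolding sum_product by (simp only: sum_distrib_left)
    ultimately show ?thesis
      by (simp only: sum.distrib cong: sum.cong)
  qed
  finally show ?thesis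
    using c by (simp add: sum_distrib_left)
qed

section \<open>Variance bounds\<close>

lemma popoviciu_inequality:
  fixes a :: "'a \<Rightarrow> real"
  assumes "finite A" "A \<noteq> {}" and bounds: "\<And>i. i \<in> A \<Longrightarrow> x \<le> a i \<and> a i \<le> y"
  defines "\<mu> \<equiv> sum a A / real (card A)"
  shows "(\<Sum>i\<in>A. (a i - \<mu>)\<^sup>2) \<le> real (card A) * ((y - x)\<^sup>2 / 4)"
proof -
  \<comment> \<open>Every value lies within half the range of the midpoint \<open>t\<close>.
    Recentring from \<open>t\<close> to the mean drops a nonnegative square and leaves a term linear
    in the deviations, which sums to zero.\<close>
  define t where "t = (x + y) / 2"
  have pointwise: "(a i - \<mu>)\<^sup>2 \<le> (y - x)\<^sup>2 / 4 - 2 * (\<mu> - t) * (a i - \<mu>)" if "i \<in> A" for i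
  proof -
    have "\<bar>a i - t\<bar> \<le> \<bar>(y - x) / 2\<bar>"
      unfolding t_def using bounds[OF that] by (auto simp: field_simps abs_if)
    then have "(a i - t)\<^sup>2 \<le> ((y - x) / 2)\<^sup>2" by (simp only: abs_le_square_iff)
    then have "(a i - t)\<^sup>2 \<le> (y - x)\<^sup>2 / 4" by (simp add: power_divide)
    moreover have "(a i - \<mu>)\<^sup>2 = (a i - t)\<^sup>2 - (\<mu> - t)\<^sup>2 - 2 * (\<mu> - t) * (a i - \<mu>)"
      by (simp add: power2_eq_square algebra_simps)
    ultimately show ?thesis by (smt (verit) zero_le_power2)
  qed
  have "(\<Sum>i\<in>A. (a i - \<mu>)\<^sup>2) \<le> (\<Sum>i\<in>A. (y - x)\<^sup>2 / 4 - 2 * (\<mu> - t) * (a i - \<mu>))"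
    by (intro sum_mono pointwise)
  also have "\<dots> = real (card A) * ((y - x)\<^sup>2 / 4) - 2 * (\<mu> - t) * (\<Sum>i\<in>A. a i - \<mu>)"
    by (simp add: sum_subtractf flip: sum_distrib_left)
  also have "(\<Sum>i\<in>A. a i - \<mu>) = 0"
    using assms(1,2) by (simp add: sum_subtractf \<mu>_def)
  finally show ?thesis by simp
qed

text \<open>Moving the centre from the mean to \<open>c\<close> adds exactly
  \<open>(?m - c)\<^sup>2\<close>. Hence an explicit centre may be used without first proving that
  it is the expectation.\<close>

lemma variance_le_second_moment:
  fixes X :: "'a \<Rightarrow> real"
  assumes "finite (set_pmf p)"
  shows "measure_pmf.variance p X \<le> measure_pmf.expectation p (\<lambda>x. (X x - c)\<^sup>2)"
proof -
  note int = integrable_measure_pmf_finite[OF assms]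
  let ?m = "measure_pmf.expectation p X"
  have "measure_pmf.expectation p (\<lambda>x. (X x - c)\<^sup>2)
      = measure_pmf.expectation p (\<lambda>x. (X x - ?m)\<^sup>2 + 2 * (?m - c) * (X x - ?m) + (?m - c)\<^sup>2)"
    by (rule arg_cong[where f = "measure_pmf.expectation p"])
      (simp add: fun_eq_iff power2_eq_square algebra_simps)
  also have "\<dots> = measure_pmf.variance p X + 2 * (?m - c) * (?m - ?m) + (?m - c)\<^sup>2"
    by (simp add: int)
  finally show ?thesis by simp
qed

lemma variance_subset_sum_le:
  fixes a :: "'a \<Rightarrow> real"
  assumes A: "finite A" "2 \<le> card A" and k: "1 \<le> k" "k \<le> card A"
    and bounds: "\<And>i. i \<in> A \<Longrightarrow> x \<le> a i \<and> a i \<le> y"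
  defines "n \<equiv> card A"
  shows "measure_pmf.variance (pmf_of_set {I. I \<subseteq> A \<and> card I = k}) (\<lambda>I. sum a I)
           \<le> real k / 4 * ((real n - real k) / (real n - 1)) * (y - x)\<^sup>2"
proof -
  let ?S = "{I. I \<subseteq> A \<and> card I = k}"
  let ?C = "real (n choose k)"
  define \<mu> where "\<mu> = sum a A / real n"
  define Q where "Q = (\<Sum>i\<in>A. (a i - \<mu>)\<^sup>2)"
  have S: "finite ?S" "card ?S = n choose k" using A by (simp_all add: n_subsets n_def)
  have C: "?C > 0" using k by (simp add: n_def)
  then have ne: "?S \<noteq> {}" using S by (metis card.empty of_nat_0 less_irrefl)
  have n: "real n > 1" "real k \<le> real n" using A k by (auto simp: n_def)
  have A_ne: "A \<noteq> {}" using A by auto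
  \<comment> \<open>As every sampled set has exactly \<open>k\<close> elements, the shift by
    \<open>k * \<mu>\<close> spreads over the summands. The deviations sum to zero over
    \<open>A\<close>, as the second-moment formula requires.\<close>
  have centred: "sum a I - real k * \<mu> = (\<Sum>i\<in>I. a i - \<mu>)" if "I \<in> ?S" for I
    using that by (simp add: sum_subtractf)
  have mean_zero: "(\<Sum>i\<in>A. a i - \<mu>) = 0"
    using n by (simp add: sum_subtractf \<mu>_def n_def)
  have "measure_pmf.variance (pmf_of_set ?S) (\<lambda>I. sum a I)
      \<le> measure_pmf.expectation (pmf_of_set ?S) (\<lambda>I. (sum a I - real k * \<mu>)\<^sup>2)"
    using S ne by (intro variance_le_second_moment) simp
  also have "\<dots> = (\<Sum>I\<in>?S. (sum a I - real k * \<mu>)\<^sup>2) / ?C"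
    using S ne by (simp add: integral_pmf_of_set)
  also have "(\<Sum>I\<in>?S. (sum a I - real k * \<mu>)\<^sup>2) = (\<Sum>I\<in>?S. (\<Sum>i\<in>I. a i - \<mu>)\<^sup>2)"
    by (rule sum.cong[OF refl]) (simp only: centred)
  also have "\<dots> = real k * (real n - real k) * ?C * Q / (real n * (real n - 1))"
    using sum_square_subset_sums[OF A(1) k mean_zero] n
    by (simp add: Q_def n_def field_simps)
  also have "\<dots> / ?C = real k * (real n - real k) / (real n * (real n - 1)) * Q"
    using C by simp
  \<comment> \<open>The factor \<open>n\<close> from Popoviciu's bound will cancel the one in the
    denominator.\<close>
  also have "\<dots> \<le> real k * (real n - real k) / (real n * (real n - 1)) * (real n * ((y - x)\<^sup>2 / 4))"
    using popoviciu_inequality[OF A(1) A_ne bounds] n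
    by (intro mult_left_mono) (auto simp: Q_def \<mu>_def n_def)
  also have "\<dots> = real k / 4 * ((real n - real k) / (real n - 1)) * (y - x)\<^sup>2"
    using n by (simp add: field_simps)
  finally show ?thesis .
qed

section \<open>Determinants and spectra of diagonal matrices\<close>

lemma bij_betw_pick:
  assumes "finite I"
  shows "bij_betw (pick I) {0..<card I} I"
proof -
  \<comment> \<open>\<open>pick I\<close> lists \<open>I\<close> in increasing order, hence
    injectively; an injection into a finite set of the same size is onto.\<close>
  have inj: "inj_on (pick I) {0..<card I}"
    by (intro linorder_inj_onI') (metis atLeastLessThan_iff less_irrefl pick_mono_le)
  moreover have "pick I ` {0..<card I} \<subseteq> I"
    using pick_in_set_le by auto
  moreover have "card (pick I ` {0..<card I}) = card I"
    using inj by (simp add: card_image)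
  ultimately show ?thesis
    using assms by (simp add: bij_betw_def card_subset_eq)
qed

text \<open>Gives access to the determinant and characteristic polynomial of triangular
  matrices.\<close>

lemma diagonal_mat_upper_triangular:
  assumes "D \<in> carrier_mat n n" "diagonal_mat D"
  shows "upper_triangular D"
  using assms by (auto simp: diagonal_mat_def)

text \<open>Injectivity of \<open>pick I\<close> sends off-diagonal positions of the submatrix to
  off-diagonal positions of \<open>D\<close>, so the submatrix is again diagonal. Its diagonal
  product is then reindexed along \<open>pick I\<close>.\<close>

lemma det_diagonal_submatrix:
  fixes D :: "'a :: comm_ring_1 mat"
  assumes D: "D \<in> carrier_mat n n" and diag: "diagonal_mat D" and I: "I \<subseteq> {0..<n}"
  shows "Determinant.det (submatrix D I I) = (\<Prod>i\<in>I. D $$ (i, i))"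
proof -
  let ?M = "submatrix D I I"
  have fin: "finite I" using I finite_subset by blast
  have set_I: "{i. i < n \<and> i \<in> I} = I" using I by auto
  have M: "?M \<in> carrier_mat (card I) (card I)"
    using D by (auto simp: dim_submatrix set_I)
  have entry: "?M $$ (i, j) = D $$ (pick I i, pick I j)" if "i < card I" "j < card I" for i j
    using that D by (subst submatrix_index) (auto simp: set_I)
  have pick_less: "pick I i < n" if "i < card I" for i
    using pick_in_set_le[OF that] I by auto
  have "upper_triangular ?M"
  proof (rule diagonal_mat_upper_triangular[OF M], unfold diagonal_mat_def, intro allI impI)
    fix i j assume "i < dim_row ?M" "j < dim_col ?M" "i \<noteq> j"
    then have ij: "i < card I" "j < card I" "i \<noteq> j" using M by auto
    then have "pick I i \<noteq> pick I j"
      using bij_betw_pick[OF fin] by (auto simp: bij_betw_def inj_on_def)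
    then show "?M $$ (i, j) = 0"
      using ij diag D pick_less by (simp add: entry diagonal_mat_def)
  qed
  then have "Determinant.det ?M = (\<Prod>i = 0..<card I. ?M $$ (i, i))"
    using M by (simp add: det_upper_triangular prod_list_diag_prod)
  also have "\<dots> = (\<Prod>i = 0..<card I. D $$ (pick I i, pick I i))"
    by (simp add: entry)
  also have "\<dots> = (\<Prod>i\<in>I. D $$ (i, i))"
    using prod.reindex_bij_betw[OF bij_betw_pick[OF fin]] by fast
  finally show ?thesis .
qed

text \<open>The characteristic polynomial splits into linear factors whose roots are the diagonal
  entries. This turns \<open>condition_number\<close> into a quotient of extreme diagonal
  entries.\<close>

lemma spectrum_diagonal:
  fixes D :: "'a :: field mat"
  assumes D: "D \<in> carrier_mat n n" and diag: "diagonal_mat D"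
  shows "spectrum D = (\<lambda>i. D $$ (i, i)) ` {0..<n}"
proof -
  have "char_poly D = (\<Prod>a\<leftarrow>diag_mat D. [:- a, 1:])"
    by (rule char_poly_upper_triangular[OF D diagonal_mat_upper_triangular[OF D diag]])
  then have "eigenvalue D e \<longleftrightarrow> e \<in> set (diag_mat D)" for e
    by (auto simp: eigenvalue_root_char_poly[OF D] poly_prod_list prod_list_zero_iff)
  then show ?thesis
    using D by (auto simp: spectrum_def diag_mat_def)
qed

text \<open>The quadratic form is evaluated at the unit vector \<open>unit_vec n i\<close>.\<close>

lemma positive_definite_diag_pos:
  assumes D: "D \<in> carrier_mat n n" and pd: "positive_definite_mat D" and i: "i < n"
  shows "D $$ (i, i) > 0"
proof -
  have u: "unit_vec n i \<in> carrier_vec n" "unit_vec n i \<noteq> (0\<^sub>v n :: real vec)"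
    using i by auto
  have "scalar_prod (unit_vec n i) (D *\<^sub>v unit_vec n i) > 0"
    using pd D u by (auto simp only: positive_definite_mat_def carrier_matD)
  moreover have "scalar_prod (unit_vec n i) (D *\<^sub>v unit_vec n i) = (D *\<^sub>v unit_vec n i) $ i"
    using D i by (intro scalar_prod_left_unit) auto
  moreover have "\<dots> = D $$ (i, i)"
    using D i by simp
  ultimately show ?thesis by simp
qed

section \<open>Variance of the log-determinant\<close>

theorem theorem3:
  fixes n k :: nat and D :: "real mat" and b \<kappa> :: real
  assumes "b > 1"
    and "n \<ge> 2"
    and "D \<in> carrier_mat n n"
    and "positive_definite_mat D"
    and "diagonal_mat D"
    and "condition_number D \<le> \<kappa>"
    and "k \<in> {1..n}"
  shows "measure_pmf.variance (random_principal_submatrix k D) (log_det b)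
           \<le> real k / 4 * ((real n - real k) / (real n - 1)) * (log b \<kappa>)\<^sup>2"
proof -
  let ?S = "{I. I \<subseteq> {0..<n} \<and> card I = k}"
  let ?P = "pmf_of_set ?S"
  define d where "d i = D $$ (i, i)" for i
  define m M where "m = Min (d ` {0..<n})" and "M = Max (d ` {0..<n})"
  have dim: "dim_row D = n" using assms(3) by simp
  have ne: "d ` {0..<n} \<noteq> {}" using assms(2) by simp
  have d_pos: "d i > 0" if "i < n" for i
    using positive_definite_diag_pos assms(3,4) that by (simp add: d_def)
  have bounds: "m \<le> d i" "d i \<le> M" if "i < n" for i
    using that by (auto simp: m_def M_def)
  have m: "m > 0" using ne d_pos by (auto simp: m_def)
  have mM: "m \<le> M" using bounds[of 0] assms(2) by simp
  have log_bounds: "log b m \<le> log b (d i) \<and> log b (d i) \<le> log b M" if "i \<in> {0..<n}" for i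
    using that bounds m d_pos assms(1) mM by simp
  have "M / m \<le> \<kappa>"
    using assms(6) spectrum_diagonal[OF assms(3,5)]
    by (simp add: condition_number_def m_def M_def d_def)
  \<comment> \<open>Makes the smaller logarithm nonnegative, so that the inequality survives
    squaring.\<close>
  moreover have "1 \<le> M / m" using m mM by simp
  ultimately have "0 \<le> log b (M / m)" "log b (M / m) \<le> log b \<kappa>"
    using assms(1) by auto
  then have log_\<kappa>: "(log b M - log b m)\<^sup>2 \<le> (log b \<kappa>)\<^sup>2"
    using m mM by (auto simp: log_divide intro: power_mono)
  have S: "finite ?S" by simp
  \<comment> \<open>The uniform distribution \<open>pmf_of_set\<close> is specified only on a
    nonempty finite set; \<open>k \<le> n\<close> guarantees this.\<close>
  have "card ?S > 0" using assms(7) by (simp add: n_subsets)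
  then have S_ne: "?S \<noteq> {}" by (metis card.empty less_irrefl)
  have log_det_eq: "log_det b (submatrix D I I) = (\<Sum>i\<in>I. log b (d i))" if "I \<in> ?S" for I
  proof -
    have "Determinant.det (submatrix D I I) = (\<Prod>i\<in>I. d i)"
      using det_diagonal_submatrix[OF assms(3,5)] that by (simp add: d_def)
    moreover have "d i \<noteq> 0" if "i \<in> I" for i
      using d_pos[of i] \<open>I \<in> ?S\<close> that by fastforce
    moreover have "finite I" using that finite_subset by auto
    ultimately show ?thesis
      by (simp add: log_det_def log_def ln_prod sum_divide_distrib)
  qed
  \<comment> \<open>The function \<open>f\<close> is kept general because the variance contains two
    expectations: the mean, with \<open>f\<close> the identity, and the outer one, with
    \<open>f\<close> the squared deviation from that mean.\<close>
  have E_eq: "measure_pmf.expectation (random_principal_submatrix k D) (\<lambda>A. f (log_det b A))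
      = measure_pmf.expectation ?P (\<lambda>I. f (\<Sum>i\<in>I. log b (d i)))" for f :: "real \<Rightarrow> real"
    unfolding random_principal_submatrix_def dim integral_map_pmf integral_pmf_of_set[OF S_ne S]
    by (simp add: log_det_eq)
  have "measure_pmf.variance (random_principal_submatrix k D) (log_det b)
      = measure_pmf.variance ?P (\<lambda>I. \<Sum>i\<in>I. log b (d i))"
    unfolding E_eq[of "\<lambda>x. x"] by (rule E_eq)
  also have "\<dots> \<le> real k / 4 * ((real n - real k) / (real n - 1)) * (log b M - log b m)\<^sup>2"
    using variance_subset_sum_le[of "{0..<n}" k "log b m" "\<lambda>i. log b (d i)" "log b M"]
      log_bounds assms(2,7) by simp
  also have "\<dots> \<le> real k / 4 * ((real n - real k) / (real n - 1)) * (log b \<kappa>)\<^sup>2"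
    using log_\<kappa> assms(2,7) by (intro mult_left_mono) auto
  finally show ?thesis .
qed

end
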